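(* Let $\varphi_e$ and $\varphi_{e_1}$ be two ruled surfaces in $\mathbb{R}^3$ that form a Bertrand surface offset, with offset angle $\theta$. Then their conical curvatures $\gamma$ and $\gamma_1$ satisfy, at corresponding parameters, $$\gamma_1=\frac{\gamma\cos\theta-\sin\theta}{\cos\theta+\gamma\sin\theta}.$$
   Context: Dual numbers are $\bar a=a+\varepsilon a^*$ with $a,a^*\in\mathbb{R}$, $\varepsilon\neq 0$, $\varepsilon^2=0$. For a differentiable real function $f$, $f(x+\varepsilon x^* )=f(x)+\varepsilon x^*f'(x)$; e.g. $\cos(x+\varepsilon x^* )=\cos x-\varepsilon x^*\sin x$, $\sin(x+\varepsilon x^* )=\sin x+\varepsilon x^*\cos x$. Dual vectors are $\tilde a=\vec a+\varepsilon\vec a^*$ with $\vec a,\vec a^*\in\mathbb{R}^3$; scalar and vector products are extended $\varepsilon$-bilinearly. A ruled surface $\varphi_e=\vec c(s)+v\,\vec e(s)$ (all data smooth) is parametrized so that $\langle \vec e,\vec e\rangle=1$, $\langle \vec e',\vec e'\rangle=1$, $\langle \vec c',\vec e'\rangle=0$, where prime is $d/ds$; so $s$ is the arc length of the real indicatrix $\vec e(s)$ and $\vec c$ is the striction line. It is represented by the dual unit vector $\tilde e=\vec e+\varepsilon\,\vec c\times\vec e$. Put $\vec t=\vec e'$, $\vec g=\vec e\times\vec t$; the conical curvature $\gamma$ is defined by $\vec e'=\vec t$, $\vec t'=\gamma\vec g-\vec e$, $\vec g'=-\gamma\vec t$. The dual Darboux frame is $\{\tilde e,\tilde t,\tilde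 g\}$ with $\tilde t=\vec t+\varepsilon\,\vec c\times\vec t$, $\tilde g=\vec g+\varepsilon\,\vec c\times\vec g$. The corresponding objects of a second ruled surface $\varphi_{e_1}$ (with its own parameter $s_1$, derivatives taken with respect to $s_1$) carry the subscript $1$. $\varphi_e$ and $\varphi_{e_1}$ form a Bertrand surface offset if, under a correspondence $s_1=s_1(s)$ between their rulings (differentiable with nonvanishing derivative), $\tilde t=\tilde t_1$ at corresponding parameters. The frames are then related by $\tilde e_1=\cos\bar\theta\,\tilde e-\sin\bar\theta\,\tilde g$, $\tilde t_1=\tilde t$, $\tilde g_1=\sin\bar\theta\,\tilde e+\cos\bar\theta\,\tilde g$, where $\bar\theta=\theta+\varepsilon\theta^*$ ($0\le\theta\le\pi$, $\theta^*\in\mathbb{R}$) is the dual angle between $\tilde e$ and $\tilde e_1$; $\theta$ is the offset angle and $\theta^*$ the offset distance. *)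

theory Defs
  imports "HOL-Analysis.Analysis"
begin

section \<open>Dual numbers and dual vectors\<close>

text \<open>\<open>Dual a b\<close> is the dual number \<open>a + \<epsilon> b\<close> with \<open>\<epsilon>\<^sup>2 = 0\<close>.\<close>

datatype dual = Dual (real_part: real) (dual_part: real)

instantiation dual :: comm_ring_1
begin

definition "0 = Dual 0 0"
definition "1 = Dual 1 0"
definition "x + y = Dual (real_part x + real_part y) (dual_part x + dual_part y)"
definition "x - y = Dual (real_part x - real_part y) (dual_part x - dual_part y)"
definition "- x = Dual (- real_part x) (- dual_part x)"
definition "x * y = Dual (real_part x * real_part y)
                         (real_part x * dual_part y + dual_part x * real_part y)"

instance
  by standard
    (auto simp: zero_dual_def one_dual_def plus_dual_def minus_dual_def uminus_dual_def
      times_dual_def algebra_simps)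

end

text \<open>Extension of a differentiable real function:
  \<open>f (x + \<epsilon> x') = f x + \<epsilon> x' f' x\<close>.\<close>

definition dual_ext :: "(real \<Rightarrow> real) \<Rightarrow> dual \<Rightarrow> dual" where
  "dual_ext f x = Dual (f (real_part x)) (dual_part x * deriv f (real_part x))"

lemma dual_ext_cos: "dual_ext cos (Dual x y) = Dual (cos x) (- y * sin x)"
proof -
  have "deriv cos x = - sin x"
    by (rule DERIV_imp_deriv) (rule DERIV_cos)
  then show ?thesis by (simp add: dual_ext_def)
qed

lemma dual_ext_sin: "dual_ext sin (Dual x y) = Dual (sin x) (y * cos x)"
proof -
  have "deriv sin x = cos x"
    by (rule DERIV_imp_deriv) (rule DERIV_sin)
  then show ?thesis by (simp add: dual_ext_def)
qed

text \<open>The dual vector \<open>a + \<epsilon> b\<close>; dual multiples of dual vectors are formed with \<open>*s\<close>.\<close>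

definition dual_vec :: "real^3 \<Rightarrow> real^3 \<Rightarrow> dual^3" where
  "dual_vec a b = (\<chi> i. Dual (a $ i) (b $ i))"


section \<open>Ruled surfaces\<close>

definition curve_deriv :: "(real \<Rightarrow> 'a::real_normed_vector) \<Rightarrow> real \<Rightarrow> 'a" where
  "curve_deriv f s = vector_derivative f (at s)"

definition smooth_curve_on :: "real set \<Rightarrow> (real \<Rightarrow> 'a::real_normed_vector) \<Rightarrow> bool" where
  "smooth_curve_on I f \<longleftrightarrow> (\<forall>n. \<forall>s\<in>I. (curve_deriv ^^ n) f differentiable (at s))"

text \<open>The ruled surface \<open>(s, v) \<mapsto> c s + v *\<^sub>R e s\<close>, with \<open>s\<close> in the open interval \<open>I\<close>,
  parametrized by the arc length of its indicatrix \<open>e\<close> and based on its striction line \<open>c\<close>.\<close>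

definition ruled_surface ::
  "real set \<Rightarrow> (real \<Rightarrow> real^3) \<Rightarrow> (real \<Rightarrow> real^3) \<Rightarrow> bool" where
  "ruled_surface I c e \<longleftrightarrow>
     open I \<and> is_interval I \<and> I \<noteq> {} \<and>
     smooth_curve_on I c \<and> smooth_curve_on I e \<and>
     (\<forall>s\<in>I. e s \<bullet> e s = 1 \<and>
            curve_deriv e s \<bullet> curve_deriv e s = 1 \<and>
            curve_deriv c s \<bullet> curve_deriv e s = 0)"

definition frame_t :: "(real \<Rightarrow> real^3) \<Rightarrow> real \<Rightarrow> real^3" where
  "frame_t e = curve_deriv e"

definition frame_g :: "(real \<Rightarrow> real^3) \<Rightarrow> real \<Rightarrow> real^3" where
  "frame_g e s = cross3 (e s) (frame_t e s)"

definition conical_curvature :: "(real \<Rightarrow> real^3) \<Rightarrow> real \<Rightarrow> real" where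
  "conical_curvature e s =
     (THE k. curve_deriv (frame_t e) s = k *\<^sub>R frame_g e s - e s \<and>
             curve_deriv (frame_g e) s = - k *\<^sub>R frame_t e s)"

definition dual_e :: "(real \<Rightarrow> real^3) \<Rightarrow> (real \<Rightarrow> real^3) \<Rightarrow> real \<Rightarrow> dual^3" where
  "dual_e c e s = dual_vec (e s) (cross3 (c s) (e s))"

definition dual_t :: "(real \<Rightarrow> real^3) \<Rightarrow> (real \<Rightarrow> real^3) \<Rightarrow> real \<Rightarrow> dual^3" where
  "dual_t c e s = dual_vec (frame_t e s) (cross3 (c s) (frame_t e s))"

definition dual_g :: "(real \<Rightarrow> real^3) \<Rightarrow> (real \<Rightarrow> real^3) \<Rightarrow> real \<Rightarrow> dual^3" where
  "dual_g c e s = dual_vec (frame_g e s) (cross3 (c s) (frame_g e s))"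


section \<open>Bertrand offsets\<close>

text \<open>The correspondence \<open>\<sigma>\<close> sends the parameter \<open>s\<close> of the first surface to the parameter
  \<open>s\<^sub>1\<close> of the second one.\<close>

definition bertrand_offset ::
  "real set \<Rightarrow> (real \<Rightarrow> real^3) \<Rightarrow> (real \<Rightarrow> real^3) \<Rightarrow>
   real set \<Rightarrow> (real \<Rightarrow> real^3) \<Rightarrow> (real \<Rightarrow> real^3) \<Rightarrow> (real \<Rightarrow> real) \<Rightarrow> bool" where
  "bertrand_offset I c e J c\<^sub>1 e\<^sub>1 \<sigma> \<longleftrightarrow>
     bij_betw \<sigma> I J \<and>
     (\<forall>s\<in>I. \<sigma> differentiable (at s) \<and> deriv \<sigma> s \<noteq> 0) \<and>
     (\<forall>s\<in>I. dual_t c e s = dual_t c\<^sub>1 e\<^sub>1 (\<sigma> s))"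

text \<open>The equality of the dual vectors \<open>t\<close> puts \<open>e\<^sub>1\<close> in the dual plane of \<open>e\<close> and \<open>g\<close>; the
  dual angle is the one that occurs in the resulting expansion. The inner product of \<open>e\<close> and
  \<open>e\<^sub>1\<close> alone would not fix the sign of the \<open>g\<close> component. The dual angle may a priori depend
  on the ruling. The companion equation for \<open>g\<^sub>1\<close> is the vector product of the one for \<open>e\<^sub>1\<close>
  with the common \<open>t\<close>.\<close>

definition dual_offset_angle ::
  "real set \<Rightarrow> (real \<Rightarrow> real^3) \<Rightarrow> (real \<Rightarrow> real^3) \<Rightarrow>
   (real \<Rightarrow> real^3) \<Rightarrow> (real \<Rightarrow> real^3) \<Rightarrow> (real \<Rightarrow> real) \<Rightarrow> (real \<Rightarrow> dual) \<Rightarrow> bool" where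
  "dual_offset_angle I c e c\<^sub>1 e\<^sub>1 \<sigma> \<Theta> \<longleftrightarrow>
     (\<forall>s\<in>I. 0 \<le> real_part (\<Theta> s) \<and> real_part (\<Theta> s) \<le> pi \<and>
        dual_e c\<^sub>1 e\<^sub>1 (\<sigma> s) =
          dual_ext cos (\<Theta> s) *s dual_e c e s - dual_ext sin (\<Theta> s) *s dual_g c e s)"

end

theory Submission
  imports Defs
begin

text \<open>The real parts of the two dual hypotheses say that along the correspondence
  \<open>t\<^sub>1 \<circ> \<sigma> = t\<close> and \<open>e\<^sub>1 \<circ> \<sigma> = cos \<theta> e - sin \<theta> g\<close>, whence
  \<open>g\<^sub>1 \<circ> \<sigma> = e\<^sub>1 \<circ> \<sigma> \<times> t = sin \<theta> e + cos \<theta> g\<close>. Denominator and numerator are obtained by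
  differentiating with respect to \<open>s\<close> and taking an inner product:

  \<^item> \<open>(e\<^sub>1 \<circ> \<sigma>) \<bullet> t\<close> vanishes identically, and its derivative is
    \<open>\<sigma>' - (cos \<theta> + \<gamma> sin \<theta>)\<close>. So the denominator is the speed \<open>\<sigma>'\<close> of the
    correspondence, and it is nonzero for that reason (\<open>offset_speed\<close>).

  \<^item> \<open>\<sigma>' (t\<^sub>1' \<circ> \<sigma>) = t' = \<gamma> g - e\<close>, and since \<open>\<gamma>\<^sub>1 = t\<^sub>1' \<bullet> g\<^sub>1\<close>, the inner product with
    \<open>g\<^sub>1 \<circ> \<sigma>\<close> gives \<open>\<sigma>' \<gamma>\<^sub>1 = \<gamma> cos \<theta> - sin \<theta>\<close>.

  The derivative of \<open>e\<^sub>1 \<circ> \<sigma>\<close> is always taken through \<open>e\<^sub>1' = t\<^sub>1\<close> and the chain rule, never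
  through its expansion in \<open>e\<close> and \<open>g\<close>. This keeps \<open>\<theta>\<close>, which is a function of the ruling
  with no regularity given in advance, out of the differentiation.\<close>

lemma smooth_curve_on_curve_deriv:
  assumes "smooth_curve_on I f" and "s \<in> I"
  shows "(f has_vector_derivative curve_deriv f s) (at s)"
    and "(curve_deriv f has_vector_derivative curve_deriv (curve_deriv f) s) (at s)"
proof -
  have "f differentiable (at s)"
    using assms unfolding smooth_curve_on_def by (metis funpow_0)
  then show "(f has_vector_derivative curve_deriv f s) (at s)"
    by (simp add: curve_deriv_def vector_derivative_works)
  have "(curve_deriv ^^ 1) f differentiable (at s)"
    using assms unfolding smooth_curve_on_def by blast
  then show "(curve_deriv f has_vector_derivative curve_deriv (curve_deriv f) s) (at s)"
    by (simp add: curve_deriv_def [where f = "curve_deriv f"] vector_derivative_works)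
qed

text \<open>The product rule for a constant inner product; each orthogonality relation of the moving
  frame is turned into a relation between derivatives in this way.\<close>

lemma constant_inner_derivative:
  fixes f h :: "real \<Rightarrow> 'a::real_inner"
  assumes "open I" and "s \<in> I"
    and f: "(f has_vector_derivative f') (at s)"
    and h: "(h has_vector_derivative h') (at s)"
    and const: "\<And>u. u \<in> I \<Longrightarrow> f u \<bullet> h u = k"
  shows "f s \<bullet> h' + f' \<bullet> h s = 0"
proof -
  have "((\<lambda>u. f u \<bullet> h u) has_vector_derivative f s \<bullet> h' + f' \<bullet> h s) (at s)"
    using bounded_bilinear.has_vector_derivative [OF bounded_bilinear_inner f h] .
  moreover have "((\<lambda>u. f u \<bullet> h u) has_vector_derivative 0) (at s)"
    by (rule has_vector_derivative_transform_within_open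
          [OF has_vector_derivative_const assms(1,2)]) (simp add: const)
  ultimately show ?thesis
    by (rule vector_derivative_unique_at)
qed

lemma frame_orthonormal:
  assumes "ruled_surface I c e" and "s \<in> I"
  shows "e s \<bullet> e s = 1" and "frame_t e s \<bullet> frame_t e s = 1" and "e s \<bullet> frame_t e s = 0"
    and "frame_g e s \<bullet> frame_g e s = 1" and "e s \<bullet> frame_g e s = 0"
    and "frame_g e s \<bullet> frame_t e s = 0"
    and "cross3 (frame_g e s) (frame_t e s) = - e s"
    and "cross3 (e s) (frame_g e s) = - frame_t e s"
proof -
  have smooth: "smooth_curve_on I e" and "open I"
    and unit: "\<And>u. u \<in> I \<Longrightarrow> e u \<bullet> e u = 1"
    using assms by (auto simp: ruled_surface_def)
  show ee: "e s \<bullet> e s = 1" and tt: "frame_t e s \<bullet> frame_t e s = 1"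
    using assms by (auto simp: ruled_surface_def frame_t_def)
  note e' = smooth_curve_on_curve_deriv(1) [OF smooth assms(2)]
  show et: "e s \<bullet> frame_t e s = 0"
    using constant_inner_derivative [OF \<open>open I\<close> assms(2) e' e' unit]
    by (simp add: frame_t_def inner_commute)
  show "frame_g e s \<bullet> frame_g e s = 1"
    using norm_cross_dot [of "e s" "frame_t e s"] ee tt et
    by (simp add: frame_g_def power_mult_distrib flip: power2_norm_eq_inner)
  show "e s \<bullet> frame_g e s = 0" "frame_g e s \<bullet> frame_t e s = 0"
    by (simp_all add: frame_g_def dot_cross_self)
  show "cross3 (frame_g e s) (frame_t e s) = - e s"
    using Lagrange [of "frame_t e s" "e s" "frame_t e s"] tt et
    by (simp add: frame_g_def cross_skew [of "cross3 _ _" "frame_t e s"] inner_commute)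
  show "cross3 (e s) (frame_g e s) = - frame_t e s"
    using Lagrange [of "e s" "e s" "frame_t e s"] ee et
    by (simp add: frame_g_def)
qed

text \<open>The conical curvature is characterized by two vector equations at once. The tangential
  component of \<open>t'\<close> vanishes because \<open>t\<close> is a unit vector, and its \<open>e\<close> component is \<open>-1\<close>
  because \<open>e \<bullet> t = 0\<close> and \<open>e' = t\<close>; the second equation then follows from the first by
  differentiating \<open>g = e \<times> t\<close>. This makes \<open>conical_curvature\<close> well defined and identifies it
  with \<open>t' \<bullet> g\<close>.\<close>

lemma conical_curvature_eq:
  assumes "ruled_surface I c e" and "s \<in> I"
  shows "curve_deriv (frame_t e) s = conical_curvature e s *\<^sub>R frame_g e s - e s"
    and "conical_curvature e s = curve_deriv (frame_t e) s \<bullet> frame_g e s"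
proof -
  have smooth: "smooth_curve_on I e" and "open I"
    using assms by (auto simp: ruled_surface_def)
  note frame = frame_orthonormal [OF assms]
  define k where "k = curve_deriv (frame_t e) s \<bullet> frame_g e s"
  have e': "(e has_vector_derivative frame_t e s) (at s)"
    and t': "(frame_t e has_vector_derivative curve_deriv (frame_t e) s) (at s)"
    using smooth_curve_on_curve_deriv [OF smooth assms(2)] by (simp_all add: frame_t_def)
  have t't: "curve_deriv (frame_t e) s \<bullet> frame_t e s = 0"
    using constant_inner_derivative
        [OF \<open>open I\<close> assms(2) t' t' frame_orthonormal(2) [OF assms(1)]]
    by (simp add: inner_commute)
  have t'e: "curve_deriv (frame_t e) s \<bullet> e s = - 1"
    using constant_inner_derivative
        [OF \<open>open I\<close> assms(2) e' t' frame_orthonormal(3) [OF assms(1)]] frame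
    by (simp add: inner_commute)
  have t'_eq: "curve_deriv (frame_t e) s = k *\<^sub>R frame_g e s - e s"
  proof -
    \<comment> \<open>A vector orthogonal to \<open>e\<close> and \<open>t\<close> is parallel to \<open>g = e \<times> t\<close>; if it is also
      orthogonal to \<open>g\<close>, it is zero.\<close>
    define w where "w = curve_deriv (frame_t e) s - (k *\<^sub>R frame_g e s - e s)"
    have "w \<bullet> e s = 0" "w \<bullet> frame_t e s = 0" "w \<bullet> frame_g e s = 0"
      using t't t'e frame
      by (simp_all add: w_def k_def inner_diff_left inner_diff_right inner_add_left inner_add_right
          inner_commute)
    moreover from this have "cross3 w (frame_g e s) = 0"
      by (simp add: frame_g_def Lagrange)
    ultimately have "w = 0"
      using norm_and_cross_eq_0 [of w "frame_g e s"] frame(4) by auto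
    then show ?thesis by (simp add: w_def)
  qed
  have "(frame_g e has_vector_derivative
      cross3 (e s) (curve_deriv (frame_t e) s) + cross3 (frame_t e s) (frame_t e s)) (at s)"
    using bounded_bilinear.has_vector_derivative
        [OF bilinear_conv_bounded_bilinear [THEN iffD1, OF bilinear_cross] e' t']
    by (simp add: frame_g_def [abs_def])
  then have "curve_deriv (frame_g e) s = cross3 (e s) (k *\<^sub>R frame_g e s - e s)"
    by (simp add: curve_deriv_def [of "frame_g e"] vector_derivative_at t'_eq)
  then have g'_eq: "curve_deriv (frame_g e) s = - k *\<^sub>R frame_t e s"
    by (simp add: Cross3.right_diff_distrib cross_mult_right frame)
  have "conical_curvature e s = k"
    unfolding conical_curvature_def
  proof (rule the_equality)
    fix k' assume "curve_deriv (frame_t e) s = k' *\<^sub>R frame_g e s - e s \<and>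
      curve_deriv (frame_g e) s = - k' *\<^sub>R frame_t e s"
    then have "k = (k' *\<^sub>R frame_g e s - e s) \<bullet> frame_g e s"
      unfolding k_def by simp
    then show "k' = k"
      by (simp add: inner_diff_left frame)
  qed (use t'_eq g'_eq in blast)
  then show "curve_deriv (frame_t e) s = conical_curvature e s *\<^sub>R frame_g e s - e s"
    and "conical_curvature e s = curve_deriv (frame_t e) s \<bullet> frame_g e s"
    using t'_eq k_def by (metis, metis)
qed

lemma bertrand_offset_correspondence:
  assumes "bertrand_offset I c e J c\<^sub>1 e\<^sub>1 \<sigma>" and "s \<in> I"
  shows "\<sigma> s \<in> J" and "(\<sigma> has_vector_derivative deriv \<sigma> s) (at s)" and "deriv \<sigma> s \<noteq> 0"
proof -
  show "\<sigma> s \<in> J" and "deriv \<sigma> s \<noteq> 0"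
    using assms by (auto simp: bertrand_offset_def bij_betw_def)
  have "\<sigma> differentiable (at s)"
    using assms by (simp add: bertrand_offset_def)
  then show "(\<sigma> has_vector_derivative deriv \<sigma> s) (at s)"
    by (simp add: DERIV_deriv_iff_real_differentiable
        flip: has_real_derivative_iff_has_vector_derivative)
qed

lemma bertrand_offset_frame_t:
  assumes "bertrand_offset I c e J c\<^sub>1 e\<^sub>1 \<sigma>" and "s \<in> I"
  shows "frame_t e\<^sub>1 (\<sigma> s) = frame_t e s"
proof -
  have "dual_t c\<^sub>1 e\<^sub>1 (\<sigma> s) $ i = dual_t c e s $ i" for i
    using assms by (simp add: bertrand_offset_def)
  then show ?thesis
    by (simp add: dual_t_def dual_vec_def vec_eq_iff)
qed

lemma dual_offset_angle_real_part:
  assumes "dual_offset_angle I c e c\<^sub>1 e\<^sub>1 \<sigma> \<Theta>" and "s \<in> I"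
  shows "e\<^sub>1 (\<sigma> s) =
    cos (real_part (\<Theta> s)) *\<^sub>R e s - sin (real_part (\<Theta> s)) *\<^sub>R frame_g e s"
proof -
  have "dual_e c\<^sub>1 e\<^sub>1 (\<sigma> s) $ i =
      (dual_ext cos (\<Theta> s) *s dual_e c e s - dual_ext sin (\<Theta> s) *s dual_g c e s) $ i" for i
    using assms by (simp add: dual_offset_angle_def)
  then show ?thesis
    by (simp add: dual_e_def dual_g_def dual_vec_def dual_ext_def times_dual_def minus_dual_def
        vec_eq_iff)
qed

text \<open>The identity \<open>(e\<^sub>1 \<circ> \<sigma>) \<bullet> t = 0\<close> is differentiated: \<open>(e\<^sub>1 \<circ> \<sigma>)' = \<sigma>' t\<close> contributes \<open>\<sigma>'\<close>,
  and \<open>t' = \<gamma> g - e\<close>, paired with \<open>e\<^sub>1 \<circ> \<sigma> = cos \<theta> e - sin \<theta> g\<close>, contributes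
  \<open>- cos \<theta> - \<gamma> sin \<theta>\<close>.\<close>

lemma offset_speed:
  assumes surf: "ruled_surface I c e" and surf\<^sub>1: "ruled_surface J c\<^sub>1 e\<^sub>1"
    and offset: "bertrand_offset I c e J c\<^sub>1 e\<^sub>1 \<sigma>"
    and angle: "dual_offset_angle I c e c\<^sub>1 e\<^sub>1 \<sigma> \<Theta>" and s: "s \<in> I"
  shows "deriv \<sigma> s =
    cos (real_part (\<Theta> s)) + conical_curvature e s * sin (real_part (\<Theta> s))"
proof -
  have "open I" and smooth: "smooth_curve_on I e" and smooth\<^sub>1: "smooth_curve_on J e\<^sub>1"
    using surf surf\<^sub>1 by (auto simp: ruled_surface_def)
  have \<sigma>J: "\<sigma> s \<in> J" and \<sigma>': "(\<sigma> has_vector_derivative deriv \<sigma> s) (at s)"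
    using bertrand_offset_correspondence [OF offset s] by auto
  have e\<^sub>1': "(e\<^sub>1 \<circ> \<sigma> has_vector_derivative deriv \<sigma> s *\<^sub>R frame_t e s) (at s)"
    using vector_diff_chain_at [OF \<sigma>' smooth_curve_on_curve_deriv(1) [OF smooth\<^sub>1 \<sigma>J]]
      bertrand_offset_frame_t [OF offset s]
    by (simp add: frame_t_def)
  have t': "(frame_t e has_vector_derivative curve_deriv (frame_t e) s) (at s)"
    using smooth_curve_on_curve_deriv(2) [OF smooth s] by (simp add: frame_t_def)
  have "(e\<^sub>1 \<circ> \<sigma>) u \<bullet> frame_t e u = 0" if "u \<in> I" for u
    using frame_orthonormal [OF surf that] dual_offset_angle_real_part [OF angle that]
    by (simp add: inner_diff_left)
  from constant_inner_derivative [OF \<open>open I\<close> s e\<^sub>1' t' this]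
  show ?thesis
    using frame_orthonormal [OF surf s]
    by (simp add: dual_offset_angle_real_part [OF angle s] conical_curvature_eq(1) [OF surf s]
        inner_diff_left inner_diff_right inner_commute algebra_simps)
qed

theorem theorem4p6:
  fixes I J :: "real set"
    and c e c\<^sub>1 e\<^sub>1 :: "real \<Rightarrow> real^3"
    and \<sigma> :: "real \<Rightarrow> real"
    and \<Theta> :: "real \<Rightarrow> dual"
    and \<theta> :: "real \<Rightarrow> real"
  assumes "ruled_surface I c e"
    and "ruled_surface J c\<^sub>1 e\<^sub>1"
    and "bertrand_offset I c e J c\<^sub>1 e\<^sub>1 \<sigma>"
    and "dual_offset_angle I c e c\<^sub>1 e\<^sub>1 \<sigma> \<Theta>"
    and "\<And>s. s \<in> I \<Longrightarrow> \<theta> s = real_part (\<Theta> s)"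
  shows "\<forall>s\<in>I.
    cos (\<theta> s) + conical_curvature e s * sin (\<theta> s) \<noteq> 0 \<and>
    conical_curvature e\<^sub>1 (\<sigma> s) =
      (conical_curvature e s * cos (\<theta> s) - sin (\<theta> s)) /
      (cos (\<theta> s) + conical_curvature e s * sin (\<theta> s))"
proof
  fix s assume s: "s \<in> I"
  have "open I" and smooth\<^sub>1: "smooth_curve_on J e\<^sub>1"
    using assms(1,2) by (auto simp: ruled_surface_def)
  have \<sigma>J: "\<sigma> s \<in> J" and \<sigma>': "(\<sigma> has_vector_derivative deriv \<sigma> s) (at s)"
    and nz: "deriv \<sigma> s \<noteq> 0"
    using bertrand_offset_correspondence [OF assms(3) s] by auto
  note frame = frame_orthonormal [OF assms(1) s]
  have speed: "deriv \<sigma> s = cos (\<theta> s) + conical_curvature e s * sin (\<theta> s)"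
    using offset_speed [OF assms(1-4) s] assms(5) [OF s] by simp
  have g\<^sub>1: "frame_g e\<^sub>1 (\<sigma> s) = sin (\<theta> s) *\<^sub>R e s + cos (\<theta> s) *\<^sub>R frame_g e s"
    using frame(7) unfolding frame_g_def [of e\<^sub>1] bertrand_offset_frame_t [OF assms(3) s]
      dual_offset_angle_real_part [OF assms(4) s]
    by (simp add: assms(5) [OF s] Cross3.left_diff_distrib cross_mult_left
        flip: frame_g_def)
  have "(frame_t e\<^sub>1 \<circ> \<sigma> has_vector_derivative
      deriv \<sigma> s *\<^sub>R curve_deriv (frame_t e\<^sub>1) (\<sigma> s)) (at s)"
    using vector_diff_chain_at [OF \<sigma>' smooth_curve_on_curve_deriv(2) [OF smooth\<^sub>1 \<sigma>J]]
    by (simp add: frame_t_def)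
  then have "(frame_t e has_vector_derivative
      deriv \<sigma> s *\<^sub>R curve_deriv (frame_t e\<^sub>1) (\<sigma> s)) (at s)"
    by (rule has_vector_derivative_transform_within_open [OF _ \<open>open I\<close> s])
      (simp add: bertrand_offset_frame_t [OF assms(3)])
  then have "curve_deriv (frame_t e) s = deriv \<sigma> s *\<^sub>R curve_deriv (frame_t e\<^sub>1) (\<sigma> s)"
    by (simp add: curve_deriv_def [of "frame_t e"] vector_derivative_at)
  then have "deriv \<sigma> s * conical_curvature e\<^sub>1 (\<sigma> s) =
      (conical_curvature e s *\<^sub>R frame_g e s - e s) \<bullet> frame_g e\<^sub>1 (\<sigma> s)"
    by (simp add: conical_curvature_eq(2) [OF assms(2) \<sigma>J]
        flip: conical_curvature_eq(1) [OF assms(1) s])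
  also have "\<dots> = conical_curvature e s * cos (\<theta> s) - sin (\<theta> s)"
    by (simp add: g\<^sub>1 inner_diff_left inner_diff_right inner_add_right frame inner_commute)
  finally have "conical_curvature e\<^sub>1 (\<sigma> s) =
      (conical_curvature e s * cos (\<theta> s) - sin (\<theta> s)) / deriv \<sigma> s"
    using nz by (simp add: field_simps)
  then show "cos (\<theta> s) + conical_curvature e s * sin (\<theta> s) \<noteq> 0 \<and>
    conical_curvature e\<^sub>1 (\<sigma> s) =
      (conical_curvature e s * cos (\<theta> s) - sin (\<theta> s)) /
      (cos (\<theta> s) + conical_curvature e s * sin (\<theta> s))"
    using nz by (simp add: speed)
qed

end
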